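(* Let $G$ be a connected non-bipartite graph with $m$ edges and diameter $D$, and let $(\mathcal{W}_t)_{t\ge0}$ be a round-fair process on $G$ with $k\ge1$ tokens. If $T\ge 16mD\ln k$, then $\mathcal{W}_T$ has discrepancy over arcs at most $10D$.
   Context: $G=(V,E)$ is a finite connected undirected graph; $\vec G=(V,\vec E)$ replaces each edge $\{u,v\}$ by arcs $(u,v),(v,u)$; $\mathrm{in}(v),\mathrm{out}(v)$ denote incoming/outgoing arcs of $v$ and $\deg(v)=|\mathrm{out}(v)|$. A round-fair process is a sequence $(\mathcal{W}_t)_{t\ge 0}$ of functions $\mathcal{W}_t:V\cup\vec E\to\mathbb{Z}_{\ge0}$ such that for all $t,v$: $\mathcal{W}_t(v)=\sum_{e\in\mathrm{out}(v)}\mathcal{W}_t(e)$; each $e\in\mathrm{out}(v)$ has $\mathcal{W}_t(e)\in\{\lfloor \mathcal{W}_t(v)/\deg(v)\rfloor,\lceil \mathcal{W}_t(v)/\deg(v)\rceil\}$; and $\mathcal{W}_{t+1}(v)=\sum_{e\in\mathrm{in}(v)}\mathcal{W}_t(e)$. The number of tokens is $k=\sum_v\mathcal{W}_0(v)$. The discrepancy over arcs of $\mathcal{W}_t$ is $\max_{e,e'\in\vec E}(\mathcal{W}_t(e)-\mathcal{W}_t(e'))$. *)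

theory Defs
  imports Complex_Main "Graph_Theory.Graph_Theory"
begin

definition finite_simple_graph :: "'a set \<Rightarrow> 'a set set \<Rightarrow> bool" where
  "finite_simple_graph V E \<longleftrightarrow> finite V \<and> (\<forall>e\<in>E. e \<subseteq> V \<and> card e = 2)"

definition bipartite :: "'a set \<Rightarrow> 'a set set \<Rightarrow> bool" where
  "bipartite V E \<longleftrightarrow>
     (\<exists>X Y. X \<union> Y = V \<and> X \<inter> Y = {} \<and> (\<forall>e\<in>E. \<exists>x\<in>X. \<exists>y\<in>Y. e = {x, y}))"

text \<open>The digraph in which every edge \<open>{u, v}\<close> is replaced by the two arcs \<open>(u, v)\<close> and
  \<open>(v, u)\<close>.\<close>

definition bidirected :: "'a set \<Rightarrow> 'a set set \<Rightarrow> ('a, 'a \<times> 'a) pre_digraph" where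
  "bidirected V E = with_proj \<lparr>pverts = V, parcs = {(u, v). {u, v} \<in> E}\<rparr>"

lemma graph_bidirected:
  assumes "finite_simple_graph V E"
  shows "graph (bidirected V E)"
proof -
  have sub: "e \<subseteq> V" "card e = 2" if "e \<in> E" for e
    using assms that by (auto simp: finite_simple_graph_def)
  have arcs: "arcs (bidirected V E) \<subseteq> V \<times> V"
    using sub(1) by (fastforce simp: bidirected_def)
  have "finite (arcs (bidirected V E))"
    using assms arcs by (meson finite_SigmaI finite_simple_graph_def finite_subset)
  moreover have "u \<noteq> v" if "{u, v} \<in> E" for u v
    using sub(2)[OF that] by auto
  ultimately show ?thesis
    using assms arcs
    by unfold_locales
      (auto simp: bidirected_def finite_simple_graph_def arc_to_ends_def symmetric_def
        arcs_ends_def insert_commute intro!: symI)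
qed

text \<open>For an unreachable \<open>v\<close> the value of \<open>distance\<close> is unspecified, so \<open>distance\<close> and
  \<open>diameter\<close> are meaningful for connected graphs only.\<close>

definition distance :: "'a set \<Rightarrow> 'a set set \<Rightarrow> 'a \<Rightarrow> 'a \<Rightarrow> nat" where
  "distance V E u v =
     (LEAST n. \<exists>p. pre_digraph.awalk (bidirected V E) u p v \<and> length p = n)"

definition diameter :: "'a set \<Rightarrow> 'a set set \<Rightarrow> nat" where
  "diameter V E = Max {distance V E u v | u v. u \<in> V \<and> v \<in> V}"

text \<open>A configuration is a function on the disjoint union of vertices (\<open>Inl\<close>) and arcs
  (\<open>Inr\<close>). Values outside of the given graph are irrelevant.\<close>

type_synonym 'a config = "'a + 'a \<times> 'a \<Rightarrow> nat"

definition round_fair :: "'a set \<Rightarrow> 'a set set \<Rightarrow> (nat \<Rightarrow> 'a config) \<Rightarrow> bool" where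
  "round_fair V E W \<longleftrightarrow>
     (\<forall>t. \<forall>v\<in>V.
        W t (Inl v) = (\<Sum>e\<in>out_arcs (bidirected V E) v. W t (Inr e)) \<and>
        (\<forall>e\<in>out_arcs (bidirected V E) v.
           int (W t (Inr e)) \<in>
             {\<lfloor>real (W t (Inl v)) / real (out_degree (bidirected V E) v)\<rfloor>,
              \<lceil>real (W t (Inl v)) / real (out_degree (bidirected V E) v)\<rceil>}) \<and>
        W (Suc t) (Inl v) = (\<Sum>e\<in>in_arcs (bidirected V E) v. W t (Inr e)))"

definition tokens :: "'a set \<Rightarrow> (nat \<Rightarrow> 'a config) \<Rightarrow> nat" where
  "tokens V W = (\<Sum>v\<in>V. W 0 (Inl v))"

definition arc_discrepancy :: "'a set \<Rightarrow> 'a set set \<Rightarrow> 'a config \<Rightarrow> int" where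
  "arc_discrepancy V E w =
     Max {int (w (Inr e)) - int (w (Inr e')) | e e'.
            e \<in> arcs (bidirected V E) \<and> e' \<in> arcs (bidirected V E)}"

end

theory Submission
  imports Defs "HOL-Analysis.Convex"
begin

text \<open>
  Let \<open>\<Phi>\<close> be the sum of the squared deviations of the arc loads from their average. In every step
  each vertex replaces its incoming loads by the most balanced integer loads with the same sum, so
  \<open>\<Phi>\<close> decreases, and a vertex that receives two loads differing by \<open>d\<close> contributes at least
  \<open>(d\<^sup>2 - 1) / 2\<close> to the decrease. As the graph is not bipartite, the tails of an arc of maximal
  and an arc of minimal load are joined by a walk of even length at most \<open>2D\<close>. Along a shortest such
  walk the vertices at odd positions are distinct, and loads of arcs with the same tail differ by at
  most one. Hence if the discrepancy \<open>\<Delta>\<close> exceeds \<open>10D\<close>, then \<open>\<Phi>\<close> decreases by at least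
  \<open>\<Delta>\<^sup>2 / (4D) \<ge> \<Phi> / (8mD)\<close>. Since \<open>\<Phi> \<le> k\<^sup>2\<close> initially, after \<open>16mD ln k\<close> such
  steps \<open>\<Phi> \<le> 1\<close>, which is impossible for a discrepancy above \<open>10D\<close>.
\<close>

section \<open>Shortest even walks and integer inequalities\<close>

text \<open>If two odd positions of an even walk carry the same vertex, cutting out the stretch
  between them removes an even number of steps and leaves a shorter even walk. A walk of least even
  length therefore has distinct vertices at its odd positions.\<close>

lemma shortest_even_walk:
  assumes "(p, q) \<in> R ^^ (2 * l)"
  obtains L w where "L \<le> l" "w 0 = p" "w (2 * L) = q"
    "\<And>i. i < 2 * L \<Longrightarrow> (w i, w (Suc i)) \<in> R" "inj_on (\<lambda>i. w (2 * i + 1)) {..<L}"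
proof -
  define L where "L = (LEAST l. (p, q) \<in> R ^^ (2 * l))"
  have walk: "(p, q) \<in> R ^^ (2 * L)" and "L \<le> l"
    and minimal: "\<And>n. (p, q) \<in> R ^^ (2 * n) \<Longrightarrow> L \<le> n"
    unfolding L_def using assms by (auto intro: LeastI Least_le)
  from walk obtain w where w: "w 0 = p" "w (2 * L) = q"
    and step: "\<And>i. i < 2 * L \<Longrightarrow> (w i, w (Suc i)) \<in> R"
    by (auto simp: relpow_fun_conv)
  have segment: "(w a, w (a + n)) \<in> R ^^ n" if "a + n \<le> 2 * L" for a n
    unfolding relpow_fun_conv using that step by (intro exI[of _ "\<lambda>i. w (a + i)"]) auto
  have False if "i < j" "j < L" "w (2 * i + 1) = w (2 * j + 1)" for i j
  proof -
    have "(p, w (2 * i + 1)) \<in> R ^^ (2 * i + 1)"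
      using segment[of 0 "2 * i + 1"] that w by simp
    moreover have "(w (2 * i + 1), q) \<in> R ^^ (2 * (L - j) - 1)"
      using segment[of "2 * j + 1" "2 * (L - j) - 1"] that w
      by (simp add: algebra_simps)
    ultimately have "(p, q) \<in> R ^^ (2 * i + 1 + (2 * (L - j) - 1))"
      unfolding relpow_add by blast
    also have "2 * i + 1 + (2 * (L - j) - 1) = 2 * (i + (L - j))"
      using that by simp
    finally show False
      using minimal[of "i + (L - j)"] that by simp
  qed
  then have "inj_on (\<lambda>i. w (2 * i + 1)) {..<L}"
    by (auto intro!: linorder_inj_onI)
  with that[of L w] \<open>L \<le> l\<close> w step show thesis by blast
qed

text \<open>The polynomial \<open>(x - f) * (x - f - 1)\<close> vanishes at \<open>f\<close> and
  \<open>f + 1\<close>, so its sum over \<open>B\<close> is 0. Summed over any set it differs from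
  the sum of squares by terms in the total and the cardinality only, and these agree for
  \<open>A\<close> and \<open>B\<close>.\<close>

lemma sum_squares_balanced:
  fixes a :: "'a \<Rightarrow> int" and b :: "'b \<Rightarrow> int"
  assumes "sum a A = sum b B" "card A = card B" "\<And>e. e \<in> B \<Longrightarrow> b e = f \<or> b e = f + 1"
  shows "(\<Sum>e\<in>A. (a e)\<^sup>2) = (\<Sum>e\<in>B. (b e)\<^sup>2) + (\<Sum>e\<in>A. (a e - f) * (a e - f - 1))"
proof -
  have expand: "(\<Sum>e\<in>C. (c e - f) * (c e - f - 1)) =
      (\<Sum>e\<in>C. (c e)\<^sup>2) - (2 * f + 1) * sum c C + int (card C) * (f * (f + 1))"
    for C :: "'c set" and c
  proof -
    have "(\<Sum>e\<in>C. (c e - f) * (c e - f - 1)) =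
        (\<Sum>e\<in>C. (c e)\<^sup>2 - (2 * f + 1) * c e + f * (f + 1))"
      by (rule sum.cong) (auto simp: algebra_simps power2_eq_square)
    then show ?thesis
      by (simp add: sum.distrib sum_subtractf sum_distrib_left)
  qed
  have "(\<Sum>e\<in>B. (b e - f) * (b e - f - 1)) = 0"
    using assms(3) by (intro sum.neutral) fastforce
  with expand[of a A] expand[of b B] assms(1,2) show ?thesis by simp
qed

text \<open>No integer lies strictly between 0 and 1. This is what makes \<open>excess\<close>
  nonnegative.\<close>

lemma mult_pred_int_nonneg: "0 \<le> x * (x - 1)" for x :: int
  by (cases "x \<ge> 1") (auto intro: mult_nonneg_nonneg mult_nonpos_nonpos)

text \<open>The right side minus the left side is \<open>(x + y - 1)\<^sup>2\<close>.\<close>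

lemma power2_diff_le_mult_pred:
  "(x - y)\<^sup>2 - 1 \<le> 2 * (x * (x - 1) + y * (y - 1))" for x y :: int
proof -
  have "0 \<le> (x + y - 1)\<^sup>2" by simp
  then show ?thesis by (simp add: power2_eq_square algebra_simps)
qed

lemma bidirected_simps [simp]:
  "verts (bidirected V E) = V"
  "arcs (bidirected V E) = {(u, v). {u, v} \<in> E}"
  "arcs_ends (bidirected V E) = {(u, v). {u, v} \<in> E}"
  "tail (bidirected V E) = fst"
  "head (bidirected V E) = snd"
  by (auto simp: bidirected_def)

text \<open>The arcs are the union over \<open>E\<close> of the sets of ordered pairs with a given
  underlying edge, each of which has at most two members.\<close>

lemma card_arcs_bidirected_le:
  assumes "finite E"
  shows "card (arcs (bidirected V E)) \<le> 2 * card E"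
proof -
  let ?S = "\<lambda>e. {(u, v). {u, v} = e}"
  have S: "finite (?S e) \<and> card (?S e) \<le> 2" for e :: "'a set"
  proof (cases "\<exists>u v. {u, v} = e")
    case True
    then obtain u v where e: "e = {u, v}" by blast
    have "?S e \<subseteq> {(u, v), (v, u)}" unfolding e by (auto simp: doubleton_eq_iff)
    moreover have "card {a, b} \<le> 2" for a b :: "'a \<times> 'a" by (simp add: card_insert_if)
    ultimately show ?thesis
      by (meson card_mono finite.emptyI finite_insert finite_subset le_trans)
  next
    case False
    then have "?S e = {}" by auto
    then show ?thesis by simp
  qed
  have "arcs (bidirected V E) = (\<Union>e\<in>E. ?S e)" by auto
  then have "card (arcs (bidirected V E)) \<le> (\<Sum>e\<in>E. card (?S e))"
    by (simp only: card_UN_le[OF assms])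
  also have "\<dots> \<le> (\<Sum>e\<in>E. 2)" using S by (intro sum_mono) blast
  finally show ?thesis by simp
qed

subsection \<open>Even walks\<close>

locale simple_graph =
  fixes V :: "'a set" and E :: "'a set set"
  assumes simple: "finite_simple_graph V E"
begin

sublocale graph "bidirected V E"
  by (rule graph_bidirected) (rule simple)

abbreviation adjacency :: "('a \<times> 'a) set" where
  "adjacency \<equiv> arcs (bidirected V E)"

lemma edge_verts: "{u, v} \<in> E \<Longrightarrow> u \<in> V \<and> v \<in> V"
  using simple by (auto simp: finite_simple_graph_def)

lemma finite_V: "finite V"
  using simple by (simp add: finite_simple_graph_def)

lemma finite_E: "finite E"
  using simple finite_V by (auto simp: finite_simple_graph_def intro: finite_subset[of E "Pow V"])

lemma finite_adjacency: "finite adjacency"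
  by (rule finite_arcs)

text \<open>Passing to relation powers turns concatenation of walks into \<open>relpow_add\<close>.
  The condition \<open>u \<in> V\<close> matters at \<open>n = 0\<close>, where the power is the
  identity on the whole type.\<close>

lemma awalk_relpow:
  "(\<exists>p. awalk u p v \<and> length p = n) \<longleftrightarrow> u \<in> V \<and> (u, v) \<in> adjacency ^^ n"
proof (induction n arbitrary: u)
  case 0
  show ?case by (auto simp: awalk_Nil_iff)
next
  case (Suc n)
  have "(\<exists>p. awalk u p v \<and> length p = Suc n) \<longleftrightarrow>
      (\<exists>w. (u, w) \<in> adjacency \<and> (\<exists>p. awalk w p v \<and> length p = n))"
  proof
    assume "\<exists>p. awalk u p v \<and> length p = Suc n"
    then obtain e p where "awalk u (e # p) v" "length p = n"
      by (auto simp: length_Suc_conv)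
    then have "(u, snd e) \<in> adjacency \<and> awalk (snd e) p v \<and> length p = n"
      by (cases e) (simp add: awalk_Cons_iff)
    then show "\<exists>w. (u, w) \<in> adjacency \<and> (\<exists>p. awalk w p v \<and> length p = n)" by blast
  next
    assume "\<exists>w. (u, w) \<in> adjacency \<and> (\<exists>p. awalk w p v \<and> length p = n)"
    then obtain w p where "(u, w) \<in> adjacency" "awalk w p v" "length p = n" by blast
    then have "awalk u ((u, w) # p) v \<and> length ((u, w) # p) = Suc n"
      by (simp add: awalk_Cons_iff)
    then show "\<exists>p. awalk u p v \<and> length p = Suc n" by blast
  qed
  also have "\<dots> \<longleftrightarrow> u \<in> V \<and> (u, v) \<in> adjacency O adjacency ^^ n"
    unfolding Suc.IH using edge_verts by auto
  finally show ?case by (simp only: relpow.simps relpow_commute)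
qed

lemma distance_relpow:
  assumes "u \<in> V"
  shows "distance V E u v = (LEAST n. (u, v) \<in> adjacency ^^ n)"
  unfolding distance_def awalk_relpow using assms by simp

lemma distance_le_diameter:
  assumes "u \<in> V" "v \<in> V"
  shows "distance V E u v \<le> diameter V E"
proof -
  have "{distance V E u v | u v. u \<in> V \<and> v \<in> V} = (\<lambda>(u, v). distance V E u v) ` (V \<times> V)"
    by auto
  then have "finite {distance V E u v | u v. u \<in> V \<and> v \<in> V}"
    using finite_V by simp
  then show ?thesis
    unfolding diameter_def using assms by (intro Max_ge) auto
qed

end

locale connected_nonbipartite_graph = simple_graph +
  assumes conn: "Digraph_Component.connected (bidirected V E)"
    and nonbipartite: "\<not> bipartite V E"
begin

text \<open>Connectedness is phrased through the symmetric closure, which adds nothing to a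
  symmetric digraph. So some walk exists and the least length is attained.\<close>

lemma distance_walk:
  assumes "u \<in> V" "v \<in> V"
  shows "(u, v) \<in> adjacency ^^ distance V E u v"
proof -
  have "u \<rightarrow>\<^sup>*\<^bsub>mk_symmetric (bidirected V E)\<^esub> v"
    using conn assms by (simp add: connected_def strongly_connected_def)
  then have "(u, v) \<in> (arcs_ends (bidirected V E))\<^sup>*"
    by (simp add: reachable_mk_symmetric_eq[OF sym_arcs] reachable_conv)
  then obtain n where "(u, v) \<in> adjacency ^^ n"
    by (auto simp: rtrancl_power)
  then show ?thesis
    unfolding distance_relpow[OF assms(1)] by (rule LeastI)
qed

text \<open>Since the parity of the distance from \<open>p\<close> is not a 2-colouring, some edge joins
  vertices of equal parity, and crossing it or not adjusts the parity of a walk through it.\<close>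

lemma even_walk:
  assumes "p \<in> V" "q \<in> V"
  obtains l where "l \<le> diameter V E" "(p, q) \<in> adjacency ^^ (2 * l)"
proof -
  let ?d = "distance V E"
  have "\<exists>a b. {a, b} \<in> E \<and> (even (?d p a) \<longleftrightarrow> even (?d p b))"
  proof (rule ccontr)
    assume neg: "\<not> ?thesis"
    have "\<exists>x\<in>{v\<in>V. even (?d p v)}. \<exists>y\<in>{v\<in>V. odd (?d p v)}. e = {x, y}" if "e \<in> E" for e
    proof -
      from that simple obtain a b where ab: "e = {a, b}"
        by (auto simp: finite_simple_graph_def card_2_iff)
      with neg that edge_verts[of a b] show ?thesis
        by (cases "even (?d p a)") (auto simp: insert_commute)
    qed
    then have "bipartite V E"
      unfolding bipartite_def
      by (intro exI[of _ "{v\<in>V. even (?d p v)}"] exI[of _ "{v\<in>V. odd (?d p v)}"]) auto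
    with nonbipartite show False ..
  qed
  then obtain a b where ab: "{a, b} \<in> E" and parity: "even (?d p a) \<longleftrightarrow> even (?d p b)"
    by blast
  have abV: "a \<in> V" "b \<in> V" using ab edge_verts by auto
  have bounds: "?d p a \<le> diameter V E" "?d p b \<le> diameter V E" "?d a q \<le> diameter V E"
    using distance_le_diameter assms abV by auto
  \<comment> \<open>The detour over the edge from \<open>b\<close> to \<open>a\<close> has at most
    \<open>D + 1 + D\<close> steps for the diameter \<open>D\<close>; being even, its length is then
    at most \<open>2 * D\<close>.\<close>
  have "\<exists>n. even n \<and> n \<le> 2 * diameter V E + 1 \<and> (p, q) \<in> adjacency ^^ n"
  proof (cases "even (?d p a + ?d a q)")
    case True
    have "(p, q) \<in> adjacency ^^ (?d p a + ?d a q)"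
      unfolding relpow_add using distance_walk assms abV by blast
    with True bounds show ?thesis by (intro exI[of _ "?d p a + ?d a q"]) auto
  next
    case False
    have "(b, a) \<in> adjacency ^^ 1" using ab by (simp add: insert_commute)
    then have "(p, q) \<in> adjacency ^^ (?d p b + 1 + ?d a q)"
      unfolding relpow_add using distance_walk assms abV by blast
    with False parity bounds show ?thesis
      by (intro exI[of _ "?d p b + 1 + ?d a q"]) auto
  qed
  then obtain n where "even n" "n \<le> 2 * diameter V E + 1" "(p, q) \<in> adjacency ^^ n"
    by blast
  with that[of "n div 2"] show thesis by auto
qed

text \<open>A graph without edges is vacuously bipartite.\<close>

lemma edge_exists: "E \<noteq> {}"
  using nonbipartite by (auto simp: bipartite_def)

lemma adjacency_nonempty: "adjacency \<noteq> {}"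
  using edge_exists simple by (fastforce simp: finite_simple_graph_def card_2_iff)

text \<open>The ends of an edge are distinct, hence at positive distance. This later absorbs
  additive constants into multiples of the diameter.\<close>

lemma diameter_pos: "diameter V E \<ge> 1"
proof (rule ccontr)
  assume neg: "\<not> ?thesis"
  obtain u v where uv: "(u, v) \<in> adjacency"
    using adjacency_nonempty by fast
  then have V: "u \<in> V" "v \<in> V" using edge_verts by auto
  then have "distance V E u v = 0" using neg distance_le_diameter by fastforce
  with distance_walk[OF V] have "u = v" by simp
  with uv no_loops show False by fastforce
qed

end

subsection \<open>Energy of a round-fair process\<close>

locale round_fair_process = simple_graph +
  fixes W :: "nat \<Rightarrow> 'a config"
  assumes fair: "round_fair V E W"
begin

definition load :: "nat \<Rightarrow> 'a \<times> 'a \<Rightarrow> int" where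
  "load t e = int (W t (Inr e))"

text \<open>The smaller of the two values that fairness permits on arcs leaving \<open>v\<close>; by
  \<open>load_level\<close> the other value can be taken to be one more, even when floor and ceiling
  coincide.\<close>

definition level :: "nat \<Rightarrow> 'a \<Rightarrow> int" where
  "level t v = \<lfloor>real (W t (Inl v)) / real (out_degree (bidirected V E) v)\<rfloor>"

text \<open>The loss in the sum of squares charged to \<open>e\<close>. The level is that of the
  head one step later, since there the load of \<open>e\<close> is redistributed.\<close>

definition excess :: "nat \<Rightarrow> 'a \<times> 'a \<Rightarrow> int" where
  "excess t e = (load t e - level (Suc t) (snd e)) * (load t e - level (Suc t) (snd e) - 1)"

lemma in_arcs_eq: "in_arcs (bidirected V E) v = {e \<in> adjacency. snd e = v}"
  by (simp add: in_arcs_def)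

lemma out_arcs_eq: "out_arcs (bidirected V E) v = {e \<in> adjacency. fst e = v}"
  by (simp add: out_arcs_def)

lemma sum_arcs_by_head:
  "sum g adjacency = (\<Sum>v\<in>V. sum g (in_arcs (bidirected V E) v))"
  unfolding in_arcs_eq
  by (rule sum.group[symmetric]) (use finite_adjacency finite_V edge_verts in auto)

lemma sum_arcs_by_tail:
  "sum g adjacency = (\<Sum>v\<in>V. sum g (out_arcs (bidirected V E) v))"
  unfolding out_arcs_eq
  by (rule sum.group[symmetric]) (use finite_adjacency finite_V edge_verts in auto)

lemma card_in_arcs: "card (in_arcs (bidirected V E) v) = out_degree (bidirected V E) v"
proof -
  have "in_arcs (bidirected V E) v = prod.swap ` out_arcs (bidirected V E) v"
    by (force simp: in_arcs_def out_arcs_def insert_commute image_iff)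
  then show ?thesis by (simp add: out_degree_def card_image)
qed

lemma load_floor_ceiling:
  assumes "e \<in> adjacency"
  shows "load t e \<in>
    {\<lfloor>real (W t (Inl (fst e))) / real (out_degree (bidirected V E) (fst e))\<rfloor>,
     \<lceil>real (W t (Inl (fst e))) / real (out_degree (bidirected V E) (fst e))\<rceil>}"
proof -
  have "fst e \<in> V" "e \<in> out_arcs (bidirected V E) (fst e)"
    using assms edge_verts by (auto simp: out_arcs_eq)
  with fair show ?thesis unfolding round_fair_def load_def by blast
qed

lemma load_level:
  assumes "e \<in> adjacency"
  shows "load t e = level t (fst e) \<or> load t e = level t (fst e) + 1"
  using load_floor_ceiling[OF assms, of t] by (auto simp: level_def ceiling_altdef split: if_splits)

lemma sum_in_load:
  assumes "v \<in> V"
  shows "(\<Sum>e\<in>in_arcs (bidirected V E) v. load t e) = int (W (Suc t) (Inl v))"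
  using fair assms unfolding round_fair_def load_def by (metis of_nat_sum)

lemma sum_out_load:
  assumes "v \<in> V"
  shows "(\<Sum>e\<in>out_arcs (bidirected V E) v. load t e) = int (W t (Inl v))"
  using fair assms unfolding round_fair_def load_def by (metis of_nat_sum)

text \<open>Grouping arcs by head at time \<open>t\<close> and by tail at time \<open>Suc t\<close>
  yields the same vertex loads, so the total is conserved.\<close>

lemma sum_load: "sum (load t) adjacency = int (tokens V W)"
proof (induction t)
  case 0
  show ?case by (simp add: sum_arcs_by_tail sum_out_load tokens_def del: bidirected_simps)
next
  case (Suc t)
  then show ?case
    unfolding sum_arcs_by_tail[of "load (Suc t)"] sum_arcs_by_head[of "load t"]
    by (simp add: sum_out_load sum_in_load)
qed

text \<open>At each vertex \<open>sum_squares_balanced\<close> compares the incoming loads with the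
  outgoing loads of the next step: equal total, equal number, and the latter take two consecutive
  values.\<close>

lemma energy_step:
  "(\<Sum>e\<in>adjacency. (load t e)\<^sup>2) =
    (\<Sum>e\<in>adjacency. (load (Suc t) e)\<^sup>2) + (\<Sum>e\<in>adjacency. excess t e)"
proof -
  let ?in = "in_arcs (bidirected V E)" and ?out = "out_arcs (bidirected V E)"
  have "(\<Sum>e\<in>?in v. (load t e)\<^sup>2) = (\<Sum>e\<in>?out v. (load (Suc t) e)\<^sup>2) + (\<Sum>e\<in>?in v. excess t e)"
    if "v \<in> V" for v
  proof -
    have "(\<Sum>e\<in>?in v. (load t e)\<^sup>2) = (\<Sum>e\<in>?out v. (load (Suc t) e)\<^sup>2) +
        (\<Sum>e\<in>?in v. (load t e - level (Suc t) v) * (load t e - level (Suc t) v - 1))"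
    proof (rule sum_squares_balanced)
      show "sum (load t) (?in v) = sum (load (Suc t)) (?out v)"
        using that by (simp add: sum_in_load sum_out_load)
      show "card (?in v) = card (?out v)"
        unfolding card_in_arcs out_degree_def ..
    qed (use load_level in \<open>auto simp: out_arcs_eq\<close>)
    also have "(\<Sum>e\<in>?in v. (load t e - level (Suc t) v) * (load t e - level (Suc t) v - 1)) =
        (\<Sum>e\<in>?in v. excess t e)"
      by (rule sum.cong) (auto simp: excess_def)
    finally show ?thesis .
  qed
  then show ?thesis
    unfolding sum_arcs_by_head[of "\<lambda>e. (load t e)\<^sup>2"] sum_arcs_by_head[of "excess t"]
      sum_arcs_by_tail[of "\<lambda>e. (load (Suc t) e)\<^sup>2"]
    by (simp add: sum.distrib)
qed

lemma excess_nonneg: "0 \<le> excess t e"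
  unfolding excess_def by (rule mult_pred_int_nonneg)

text \<open>Two distinct arcs into \<open>v\<close> share the same level, so
  \<open>power2_diff_le_mult_pred\<close> applies to their deviations from it. For
  \<open>u = u'\<close> the left side is -1.\<close>

lemma excess_in_arcs:
  assumes "(u, v) \<in> adjacency" "(u', v) \<in> adjacency"
  shows "(load t (u, v) - load t (u', v))\<^sup>2 - 1 \<le>
    2 * (\<Sum>e\<in>in_arcs (bidirected V E) v. excess t e)"
proof (cases "u = u'")
  case True
  have "0 \<le> (\<Sum>e\<in>in_arcs (bidirected V E) v. excess t e)"
    by (rule sum_nonneg) (rule excess_nonneg)
  with True show ?thesis by simp
next
  case False
  have "(load t (u, v) - load t (u', v))\<^sup>2 - 1 \<le> 2 * (excess t (u, v) + excess t (u', v))"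
    using power2_diff_le_mult_pred[of "load t (u, v) - level (Suc t) v" "load t (u', v) - level (Suc t) v"]
    by (simp add: excess_def)
  also have "excess t (u, v) + excess t (u', v) = (\<Sum>e\<in>{(u, v), (u', v)}. excess t e)"
    using False by simp
  also have "\<dots> \<le> (\<Sum>e\<in>in_arcs (bidirected V E) v. excess t e)"
    using assms finite_adjacency
    by (intro sum_mono2) (auto simp: in_arcs_eq excess_nonneg)
  finally show ?thesis by simp
qed

section \<open>Monotonicity of the extremal loads\<close>

text \<open>The average load entering a vertex is at most \<open>M\<close>, and so is its ceiling,
  as \<open>M\<close> is an integer. Dually, \<open>load_step_ge\<close> uses the floor.\<close>

lemma load_step_le:
  assumes "\<And>e. e \<in> adjacency \<Longrightarrow> load t e \<le> M" "e \<in> adjacency"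
  shows "load (Suc t) e \<le> M"
proof -
  let ?v = "fst e"
  let ?n = "out_degree (bidirected V E) ?v"
  have v: "?v \<in> V" using assms(2) edge_verts by auto
  have "e \<in> out_arcs (bidirected V E) ?v" using assms(2) by (simp add: out_arcs_eq)
  then have n: "?n > 0"
    unfolding out_degree_def using finite_adjacency by (auto simp: out_arcs_eq card_gt_0_iff)
  have "int (W (Suc t) (Inl ?v)) \<le> int ?n * M"
    unfolding sum_in_load[OF v, symmetric] card_in_arcs[symmetric]
    using assms(1) by (intro sum_bounded_above) (auto simp: in_arcs_eq)
  then have "real_of_int (int (W (Suc t) (Inl ?v))) \<le> real_of_int (int ?n * M)"
    by (simp only: of_int_le_iff)
  then have "real (W (Suc t) (Inl ?v)) / real ?n \<le> real_of_int M"
    using n by (simp add: field_simps)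
  then have "\<lceil>real (W (Suc t) (Inl ?v)) / real ?n\<rceil> \<le> M" by (simp add: ceiling_le_iff)
  then show ?thesis using load_floor_ceiling[OF assms(2), of "Suc t"]
    by (auto intro: order_trans[OF floor_le_ceiling])
qed

lemma load_step_ge:
  assumes "\<And>e. e \<in> adjacency \<Longrightarrow> M \<le> load t e" "e \<in> adjacency"
  shows "M \<le> load (Suc t) e"
proof -
  let ?v = "fst e"
  let ?n = "out_degree (bidirected V E) ?v"
  have v: "?v \<in> V" using assms(2) edge_verts by auto
  have "e \<in> out_arcs (bidirected V E) ?v" using assms(2) by (simp add: out_arcs_eq)
  then have n: "?n > 0"
    unfolding out_degree_def using finite_adjacency by (auto simp: out_arcs_eq card_gt_0_iff)
  have "int ?n * M \<le> int (W (Suc t) (Inl ?v))"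
    unfolding sum_in_load[OF v, symmetric] card_in_arcs[symmetric]
    using assms(1) by (intro sum_bounded_below) (auto simp: in_arcs_eq)
  then have "real_of_int (int ?n * M) \<le> real_of_int (int (W (Suc t) (Inl ?v)))"
    by (simp only: of_int_le_iff)
  then have "real_of_int M \<le> real (W (Suc t) (Inl ?v)) / real ?n"
    using n by (simp add: field_simps)
  then have "M \<le> \<lfloor>real (W (Suc t) (Inl ?v)) / real ?n\<rfloor>" by (simp add: le_floor_iff)
  then show ?thesis using load_floor_ceiling[OF assms(2), of "Suc t"]
    by (auto intro: order_trans[OF _ floor_le_ceiling])
qed

lemma load_le:
  assumes "t \<le> T" "\<And>e. e \<in> adjacency \<Longrightarrow> load t e \<le> M" "e \<in> adjacency"
  shows "load T e \<le> M"
  using assms(1,3)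
  by (induction T arbitrary: e rule: dec_induct) (use assms(2) load_step_le in blast)+

lemma load_ge:
  assumes "t \<le> T" "\<And>e. e \<in> adjacency \<Longrightarrow> M \<le> load t e" "e \<in> adjacency"
  shows "M \<le> load T e"
  using assms(1,3)
  by (induction T arbitrary: e rule: dec_induct) (use assms(2) load_step_ge in blast)+

text \<open>The maximal load never grows and the minimal load never shrinks, so a large spread at
  time \<open>T\<close> forces one at least as large at every earlier time.\<close>

lemma extremal_arcs:
  assumes "t \<le> T" "e \<in> adjacency" "e' \<in> adjacency"
  obtains f f' where "f \<in> adjacency" "f' \<in> adjacency"
    "load T e - load T e' \<le> load t f - load t f'"
    "\<And>g. g \<in> adjacency \<Longrightarrow> load t f' \<le> load t g \<and> load t g \<le> load t f"
proof -
  let ?L = "load t ` adjacency"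
  have fin: "finite ?L" and ne: "?L \<noteq> {}" using finite_adjacency assms(2) by blast+
  obtain f where f: "f \<in> adjacency" "load t f = Max ?L"
    using Max_in[OF fin ne] by (metis imageE)
  obtain f' where f': "f' \<in> adjacency" "load t f' = Min ?L"
    using Min_in[OF fin ne] by (metis imageE)
  have bounds: "load t f' \<le> load t g \<and> load t g \<le> load t f" if "g \<in> adjacency" for g
    using that f(2) f'(2) fin by (metis Max_ge Min_le imageI)
  have "load T e \<le> load t f" "load t f' \<le> load T e'"
    using load_le[OF assms(1) _ assms(2)] load_ge[OF assms(1) _ assms(3)] bounds by blast+
  with that[OF f(1) f'(1) _ bounds] show thesis by simp
qed

section \<open>The potential and its comparison with the spread\<close>

text \<open>The mean is constant in time by \<open>sum_load\<close>, so the potential changes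
  exactly as the sum of squares does. Centring allows an upper bound by the spread.\<close>

definition potential :: "nat \<Rightarrow> real" where
  "potential t = (\<Sum>e\<in>adjacency. (load t e - tokens V W / card adjacency)\<^sup>2)"

lemma potential_eq:
  assumes "adjacency \<noteq> {}"
  shows "potential t = (\<Sum>e\<in>adjacency. (load t e)\<^sup>2) - (tokens V W)\<^sup>2 / card adjacency"
proof -
  define A where "A = adjacency"
  define N where "N = real (card A)"
  have N: "N > 0" using assms finite_adjacency by (simp add: N_def A_def card_gt_0_iff)
  define k where "k = real (tokens V W)"
  have k: "(\<Sum>e\<in>A. real_of_int (load t e)) = k"
    using sum_load[of t] unfolding k_def A_def by (metis of_int_of_nat_eq of_int_sum)
  have "potential t = (\<Sum>e\<in>A. (real_of_int (load t e) - k / N)\<^sup>2)"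
    by (simp add: potential_def A_def N_def k_def)
  also have "\<dots> = (\<Sum>e\<in>A. (real_of_int (load t e))\<^sup>2 - 2 * (k / N) * load t e + (k / N)\<^sup>2)"
    by (intro sum.cong) (auto simp: power2_eq_square algebra_simps)
  also have "\<dots> = (\<Sum>e\<in>A. (real_of_int (load t e))\<^sup>2) - 2 * (k / N) * k + N * (k / N)\<^sup>2"
    unfolding sum.distrib sum_subtractf sum_distrib_left[symmetric] k by (simp add: N_def)
  also have "\<dots> = (\<Sum>e\<in>A. (real_of_int (load t e))\<^sup>2) - k\<^sup>2 / N"
    using N by (simp add: field_simps power2_eq_square)
  finally show ?thesis by (simp add: A_def N_def k_def)
qed

lemma potential_step:
  assumes "adjacency \<noteq> {}"
  shows "potential (Suc t) = potential t - (\<Sum>e\<in>adjacency. excess t e)"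
  unfolding potential_eq[OF assms] energy_step[of t] by simp

lemma potential_nonneg: "potential t \<ge> 0"
  unfolding potential_def by (rule sum_nonneg) simp

text \<open>Each load is nonnegative and at most the total \<open>k\<close>, so the squares sum to
  at most \<open>k\<close> times the total.\<close>

lemma potential_0_le:
  assumes "adjacency \<noteq> {}"
  shows "potential 0 \<le> (real (tokens V W))\<^sup>2"
proof -
  let ?k = "int (tokens V W)"
  have "(\<Sum>e\<in>adjacency. (load 0 e)\<^sup>2) \<le> (\<Sum>e\<in>adjacency. load 0 e * ?k)"
  proof (rule sum_mono)
    fix e assume "e \<in> adjacency"
    then have "load 0 e \<le> sum (load 0) adjacency"
      using finite_adjacency by (intro member_le_sum) (auto simp: load_def)
    then show "(load 0 e)\<^sup>2 \<le> load 0 e * ?k"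
      unfolding sum_load power2_eq_square by (intro mult_left_mono) (auto simp: load_def)
  qed
  also have "\<dots> = ?k\<^sup>2"
    by (simp only: sum_distrib_right[symmetric] sum_load power2_eq_square)
  finally have "real_of_int (\<Sum>e\<in>adjacency. (load 0 e)\<^sup>2) \<le> real_of_int (?k\<^sup>2)"
    by (simp only: of_int_le_iff)
  then have "real_of_int (\<Sum>e\<in>adjacency. (load 0 e)\<^sup>2) \<le> (real (tokens V W))\<^sup>2"
    by simp
  moreover have "0 \<le> (real (tokens V W))\<^sup>2 / real (card adjacency)"
    by (intro divide_nonneg_nonneg) auto
  ultimately show ?thesis unfolding potential_eq[OF assms] of_nat_power by linarith
qed

text \<open>The mean lies between \<open>a\<close> and \<open>b\<close> as well, so every deviation
  is at most \<open>b - a\<close>.\<close>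

lemma potential_le_spread:
  assumes "adjacency \<noteq> {}"
    and bounds: "\<And>g. g \<in> adjacency \<Longrightarrow> a \<le> load t g \<and> load t g \<le> b"
  shows "potential t \<le> card adjacency * (real_of_int (b - a))\<^sup>2"
proof -
  define N where "N = real (card adjacency)"
  define k where "k = real (tokens V W)"
  have N: "N > 0" unfolding N_def using assms(1) finite_adjacency card_gt_0_iff of_nat_0_less_iff by blast
  have k: "(\<Sum>e\<in>adjacency. real_of_int (load t e)) = k"
    using sum_load[of t] unfolding k_def by (metis of_int_of_nat_eq of_int_sum)
  have "k \<le> N * b" unfolding k[symmetric] N_def
    using bounds by (intro sum_bounded_above) simp
  moreover have "N * a \<le> k" unfolding k[symmetric] N_def
    using bounds by (intro sum_bounded_below) simp
  ultimately have mean: "a \<le> k / N" "k / N \<le> b"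
    using N by (simp_all add: field_simps)
  show ?thesis unfolding potential_def k_def[symmetric]
  proof (rule sum_bounded_above)
    fix e assume e: "e \<in> adjacency"
    have "\<bar>load t e - k / N\<bar> \<le> \<bar>real_of_int (b - a)\<bar>"
      using bounds[OF e] mean by linarith
    then show "(load t e - k / real (card adjacency))\<^sup>2 \<le> (real_of_int (b - a))\<^sup>2"
      unfolding N_def by (simp only: abs_le_square_iff)
  qed
qed

text \<open>The deviations of the two arcs alone suffice; the inequality behind it has slack
  \<open>(x + y - 2 * c)\<^sup>2\<close>.\<close>

lemma spread_le_potential:
  assumes "e \<in> adjacency" "e' \<in> adjacency"
  shows "(real_of_int (load t e - load t e'))\<^sup>2 \<le> 2 * potential t"
proof (cases "e = e'")
  case True
  then show ?thesis using potential_nonneg by simp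
next
  case False
  let ?c = "tokens V W / card adjacency"
  have "(\<Sum>g\<in>{e, e'}. (load t g - ?c)\<^sup>2) \<le> potential t"
    unfolding potential_def using assms finite_adjacency by (intro sum_mono2) auto
  then have "(load t e - ?c)\<^sup>2 + (load t e' - ?c)\<^sup>2 \<le> potential t"
    using False by simp
  moreover have "(x - y)\<^sup>2 \<le> 2 * ((x - c)\<^sup>2 + (y - c)\<^sup>2)" for x y c :: real
  proof -
    have "0 \<le> (x + y - 2 * c)\<^sup>2" by simp
    then show ?thesis by (simp add: power2_eq_square algebra_simps)
  qed
  ultimately show ?thesis by (smt (verit) of_int_diff)
qed

section \<open>Loads and excess along a walk\<close>

text \<open>The difference telescopes. Each odd vertex is entered from both of its neighbours on the
  walk, the second arc running against the walk. At each of the \<open>n + 1\<close> even positions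
  one changes between arcs with a common tail, at a cost of at most 1.\<close>

lemma spread_along_walk:
  assumes walk: "\<And>i. i < 2 * n \<Longrightarrow> (w i, w (Suc i)) \<in> adjacency"
    and "e \<in> adjacency" "fst e = w 0" "e' \<in> adjacency" "fst e' = w (2 * n)"
  shows "load t e - load t e' \<le>
    (\<Sum>i<n. load t (w (2 * i), w (2 * i + 1)) - load t (w (2 * i + 2), w (2 * i + 1))) + int n + 1"
  using walk assms(4,5)
proof (induction n arbitrary: e')
  case 0
  then show ?case
    using load_level[OF assms(2), of t] load_level[of e' t] assms(3) by auto
next
  case (Suc n)
  let ?f = "(w (2 * n), w (2 * n + 1))" and ?g = "(w (2 * n + 2), w (2 * n + 1))"
  have f: "?f \<in> adjacency" using Suc.prems(1)[of "2 * n"] by simp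
  have g: "?g \<in> adjacency" using Suc.prems(1)[of "2 * n + 1"] by (simp add: insert_commute)
  \<comment> \<open>The induction hypothesis is used with \<open>?f\<close>, whose tail is
    \<open>w (2 * n)\<close>, as the last arc.\<close>
  have "load t e - load t ?f \<le>
      (\<Sum>i<n. load t (w (2 * i), w (2 * i + 1)) - load t (w (2 * i + 2), w (2 * i + 1))) + int n + 1"
    using Suc.prems(1) f by (intro Suc.IH) auto
  moreover have "load t ?g - load t e' \<le> 1"
    using load_level[OF g, of t] load_level[OF Suc.prems(2), of t] Suc.prems(3) by auto
  ultimately show ?case by simp
qed

text \<open>As the odd vertices are distinct, their incoming arcs are disjoint and the bounds of
  \<open>excess_in_arcs\<close> add up without double counting; the term \<open>n\<close> collects
  the -1 of each.\<close>

lemma excess_along_walk: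
  assumes walk: "\<And>i. i < 2 * n \<Longrightarrow> (w i, w (Suc i)) \<in> adjacency"
    and inj: "inj_on (\<lambda>i. w (2 * i + 1)) {..<n}"
  shows "(\<Sum>i<n. (load t (w (2 * i), w (2 * i + 1)) - load t (w (2 * i + 2), w (2 * i + 1)))\<^sup>2)
    \<le> 2 * (\<Sum>e\<in>adjacency. excess t e) + int n"
proof -
  let ?d = "\<lambda>i. load t (w (2 * i), w (2 * i + 1)) - load t (w (2 * i + 2), w (2 * i + 1))"
  let ?o = "\<lambda>i. w (2 * i + 1)"
  let ?X = "\<lambda>v. \<Sum>e\<in>in_arcs (bidirected V E) v. excess t e"
  have "(\<Sum>i<n. (?d i)\<^sup>2 - 1) \<le> (\<Sum>i<n. 2 * ?X (?o i))"
  proof (rule sum_mono)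
    fix i assume "i \<in> {..<n}"
    then show "(?d i)\<^sup>2 - 1 \<le> 2 * ?X (?o i)"
      using walk[of "2 * i"] walk[of "2 * i + 1"]
      by (intro excess_in_arcs) (auto simp: insert_commute)
  qed
  also have "\<dots> = 2 * (\<Sum>v\<in>?o ` {..<n}. ?X v)"
    unfolding sum.reindex[OF inj] comp_def by (simp only: sum_distrib_left)
  also have "(\<Sum>v\<in>?o ` {..<n}. ?X v) \<le> (\<Sum>v\<in>V. ?X v)"
  proof (rule sum_mono2[OF finite_V])
    show "?o ` {..<n} \<subseteq> V"
    proof clarify
      fix i assume "i < n"
      then show "?o i \<in> V" using walk[of "2 * i"] edge_verts by simp
    qed
    show "0 \<le> ?X v" for v by (rule sum_nonneg) (rule excess_nonneg)
  qed
  also have "\<dots> = (\<Sum>e\<in>adjacency. excess t e)"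
    by (rule sum_arcs_by_head[symmetric])
  finally show ?thesis by (simp add: sum_subtractf)
qed

end

section \<open>Contraction of the potential and the final bound\<close>

locale connected_round_fair_process = connected_nonbipartite_graph + round_fair_process
begin

text \<open>The spread is distributed over at most \<open>D\<close> odd vertices of a shortest even
  walk, and Cauchy-Schwarz turns the sum of the differences into a sum of squares, which the excess
  bounds.\<close>

lemma excess_lower_bound:
  assumes "e \<in> adjacency" "e' \<in> adjacency"
    and large: "load t e - load t e' > 10 * int (diameter V E)"
  shows "(load t e - load t e')\<^sup>2 \<le> 4 * int (diameter V E) * (\<Sum>e\<in>adjacency. excess t e)"
proof -
  define D where "D = int (diameter V E)"
  define \<Delta> where "\<Delta> = load t e - load t e'"
  define X where "X = (\<Sum>e\<in>adjacency. excess t e)"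
  have D: "D \<ge> 1" using diameter_pos by (simp add: D_def)
  have \<Delta>: "\<Delta> > 10 * D" using large by (simp add: \<Delta>_def D_def)
  have "fst e \<in> V" "fst e' \<in> V" using assms edge_verts by auto
  then obtain l where l: "l \<le> diameter V E" "(fst e, fst e') \<in> adjacency ^^ (2 * l)"
    by (rule even_walk)
  from l(2) obtain L w where Ll: "L \<le> l" and ends: "w 0 = fst e" "w (2 * L) = fst e'"
    and walk: "\<And>i. i < 2 * L \<Longrightarrow> (w i, w (Suc i)) \<in> adjacency"
    and inj: "inj_on (\<lambda>i. w (2 * i + 1)) {..<L}"
    by (rule shortest_even_walk) blast
  have LD: "int L \<le> D" using Ll l(1) by (simp add: D_def)
  let ?d = "\<lambda>i. load t (w (2 * i), w (2 * i + 1)) - load t (w (2 * i + 2), w (2 * i + 1))"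
  define S where "S = (\<Sum>i<L. ?d i)"
  define Q where "Q = (\<Sum>i<L. (?d i)\<^sup>2)"
  have "\<Delta> \<le> S + int L + 1"
    unfolding \<Delta>_def S_def
    by (rule spread_along_walk[of L w, OF walk]) (use assms(1,2) ends in simp_all)
  \<comment> \<open>Here \<open>L + 1 \<le> 2 * D\<close> because \<open>L \<le> D\<close> and
    \<open>1 \<le> D\<close>.\<close>
  then have S: "0 \<le> \<Delta> - 2 * D" "\<Delta> - 2 * D \<le> S" using LD D \<Delta> by auto
  have Q: "Q \<le> 2 * X + int L"
    unfolding Q_def X_def by (rule excess_along_walk[OF walk inj])
  have "real_of_int (S\<^sup>2) \<le> real_of_int (Q * int L)"
    using sum_squared_le_sum_of_squares[of "\<lambda>i. real_of_int (?d i)" "{..<L}"]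
    by (simp add: S_def Q_def)
  then have "S\<^sup>2 \<le> Q * int L" by (simp only: of_int_le_iff)
  also have "\<dots> \<le> (2 * X + int L) * int L" using Q by (intro mult_right_mono) auto
  also have "\<dots> \<le> (2 * X + D) * D"
    using LD D sum_nonneg[of adjacency "excess t", OF excess_nonneg]
    by (intro mult_mono) (auto simp: X_def)
  finally have "S\<^sup>2 \<le> (2 * X + D) * D" .
  moreover have "(\<Delta> - 2 * D)\<^sup>2 \<le> S\<^sup>2" using S by (intro power_mono) auto
  \<comment> \<open>This is where the threshold \<open>10 * D\<close> enters. Doubling the bounds
    above leaves \<Delta>^2 - 8 \<Delta> D + 6 D^2 \<ge> 0 to be shown, and that expression is this
    product plus 26 D^2.\<close>
  moreover have "0 \<le> (\<Delta> - 10 * D) * (\<Delta> + 2 * D)" using \<Delta> D by (intro mult_nonneg_nonneg) auto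
  moreover have "1 \<le> D * D" using mult_mono[of 1 D 1 D] D by simp
  ultimately have "\<Delta>\<^sup>2 \<le> 4 * D * X"
    by (simp add: power2_eq_square algebra_simps)
  then show ?thesis by (simp add: \<Delta>_def D_def X_def)
qed

text \<open>For the spread \<Delta> at time \<open>t\<close>, the drop is at least \<Delta>^2 / (4
  D) while the potential is at most 2 m \<Delta>^2. \<open>extremal_arcs\<close> carries the
  threshold from \<open>T\<close> back to \<open>t\<close>.\<close>

lemma potential_contraction:
  assumes "t \<le> T" "e \<in> adjacency" "e' \<in> adjacency"
    and large: "load T e - load T e' > 10 * int (diameter V E)"
  shows "potential (Suc t) \<le> (1 - 1 / (8 * card E * diameter V E)) * potential t"
proof -
  define D where "D = real (diameter V E)"
  define m where "m = real (card E)"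
  define X where "X = real_of_int (\<Sum>e\<in>adjacency. excess t e)"
  have pos: "D > 0" "m > 0"
    using diameter_pos edge_exists finite_E by (simp_all add: D_def m_def card_gt_0_iff)
  obtain f f' where f: "f \<in> adjacency" "f' \<in> adjacency"
    and spread: "load T e - load T e' \<le> load t f - load t f'"
    and bounds: "\<And>g. g \<in> adjacency \<Longrightarrow> load t f' \<le> load t g \<and> load t g \<le> load t f"
    using extremal_arcs[OF assms(1-3)] by blast
  define \<Delta> where "\<Delta> = real_of_int (load t f - load t f')"
  have "(load t f - load t f')\<^sup>2 \<le> 4 * int (diameter V E) * (\<Sum>e\<in>adjacency. excess t e)"
    using f large spread by (intro excess_lower_bound) auto
  then have "real_of_int ((load t f - load t f')\<^sup>2) \<le>
      real_of_int (4 * int (diameter V E) * (\<Sum>e\<in>adjacency. excess t e))"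
    by (simp only: of_int_le_iff)
  then have "\<Delta>\<^sup>2 \<le> 4 * D * X"
    by (simp add: \<Delta>_def D_def X_def)
  moreover have "potential t \<le> 2 * m * \<Delta>\<^sup>2"
  proof -
    have "potential t \<le> card adjacency * \<Delta>\<^sup>2"
      unfolding \<Delta>_def using adjacency_nonempty bounds by (rule potential_le_spread)
    also have "real (card adjacency) \<le> 2 * m"
      using card_arcs_bidirected_le[OF finite_E, of V] unfolding m_def
      by (metis of_nat_le_iff of_nat_mult of_nat_numeral)
    finally show ?thesis by (simp add: mult_right_mono)
  qed
  ultimately have "potential t \<le> 2 * m * (4 * D * X)"
    using pos by (smt (verit) mult_left_mono)
  then have "potential t / (8 * m * D) \<le> X"
    using pos by (simp add: field_simps)
  then show ?thesis
    unfolding potential_step[OF adjacency_nonempty] X_def[symmetric]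
    by (simp add: D_def m_def algebra_simps)
qed

lemma load_diff_le:
  assumes "tokens V W \<ge> 1"
    and T: "real T \<ge> 16 * real (card E) * real (diameter V E) * ln (real (tokens V W))"
    and e: "e \<in> adjacency" "e' \<in> adjacency"
  shows "load T e - load T e' \<le> 10 * int (diameter V E)"
proof (rule ccontr)
  assume "\<not> ?thesis"
  then have large: "load T e - load T e' > 10 * int (diameter V E)" by simp
  define c where "c = 8 * real (card E) * real (diameter V E)"
  define k where "k = real (tokens V W)"
  have "k > 0" using assms(1) by (simp add: k_def)
  \<comment> \<open>This keeps the contraction factor \<open>1 - 1 / c\<close> nonnegative, as both
    monotonicity arguments below require.\<close>
  have c: "c \<ge> 1"
  proof -
    have "1 \<le> 8 * card E * diameter V E"
      using diameter_pos edge_exists finite_E by (simp add: Suc_le_eq card_gt_0_iff)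
    then have "real 1 \<le> real (8 * card E * diameter V E)" by (simp only: of_nat_le_iff)
    then show ?thesis by (simp add: c_def)
  qed
  have "potential t \<le> (1 - 1 / c) ^ t * k\<^sup>2" if "t \<le> T" for t
    using that
  proof (induction t)
    case 0
    then show ?case using potential_0_le[OF adjacency_nonempty] by (simp add: k_def)
  next
    case (Suc t)
    have "potential (Suc t) \<le> (1 - 1 / c) * potential t"
      using potential_contraction[OF _ e large, of t] Suc.prems by (simp add: c_def)
    also have "\<dots> \<le> (1 - 1 / c) * ((1 - 1 / c) ^ t * k\<^sup>2)"
      using Suc c by (intro mult_left_mono) auto
    finally show ?case by (simp add: mult.assoc)
  qed
  then have "potential T \<le> (1 - 1 / c) ^ T * k\<^sup>2" by simp
  also have "(1 - 1 / c) ^ T \<le> exp (- (1 / c)) ^ T"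
    using c exp_ge_add_one_self[of "- (1 / c)"] by (intro power_mono) auto
  also have "\<dots> = exp (- (T / c))"
    by (simp add: exp_of_nat_mult[symmetric])
  \<comment> \<open>The lower bound on \<open>T\<close> equals \<open>2 * c * ln k\<close>; the
    factor 2 cancels the initial bound \<open>k\<^sup>2\<close>.\<close>
  also have "\<dots> \<le> exp (- (2 * ln k))"
    using T c by (simp add: c_def k_def field_simps)
  also have "\<dots> = 1 / k\<^sup>2"
    using \<open>k > 0\<close> by (simp add: exp_minus exp_double divide_inverse)
  finally have "potential T \<le> 1"
    using \<open>k > 0\<close> by (simp add: mult_right_mono)
  \<comment> \<open>The spread exceeds 10, yet its square is at most twice a potential of at most
    1.\<close>
  moreover have "10\<^sup>2 \<le> (real_of_int (load T e - load T e'))\<^sup>2"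
    using large diameter_pos by (intro power_mono) linarith+
  ultimately show False
    using spread_le_potential[OF e, of T] by simp
qed

end

theorem theorem5:
  fixes V :: "'a set" and E :: "'a set set"
    and W :: "nat \<Rightarrow> 'a config"
    and m D k T :: nat
  assumes "finite_simple_graph V E"
    and "Digraph_Component.connected (bidirected V E)"
    and "\<not> bipartite V E"
    and "m = card E"
    and "D = diameter V E"
    and "round_fair V E W"
    and "k = tokens V W"
    and "k \<ge> 1"
    and "real T \<ge> 16 * real m * real D * ln (real k)"
  shows "arc_discrepancy V E (W T) \<le> 10 * int D"
proof -
  interpret connected_round_fair_process V E W
    by unfold_locales (use assms in auto)
  let ?S = "{int (W T (Inr e)) - int (W T (Inr e')) | e e'. e \<in> adjacency \<and> e' \<in> adjacency}"
  \<comment> \<open>Disabling \<open>bidirected_simps\<close> keeps \<open>adjacency\<close> folded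
    as the index set.\<close>
  have "?S = (\<lambda>(e, e'). int (W T (Inr e)) - int (W T (Inr e'))) ` (adjacency \<times> adjacency)"
    by (auto simp del: bidirected_simps)
  then have "finite ?S" "?S \<noteq> {}"
    using finite_adjacency adjacency_nonempty by (simp_all del: bidirected_simps)
  moreover have "x \<le> 10 * int D" if "x \<in> ?S" for x
    using that load_diff_le[of T] assms by (auto simp: load_def simp del: bidirected_simps)
  ultimately show ?thesis
    unfolding arc_discrepancy_def by (subst Max_le_iff) auto
qed

end
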